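(* Let $G$ be a Lie group. (i) Let $(X,\omega,\Phi)$ be a Hamiltonian $G$-space with proper $G$-action on $X$, and let $C=\Phi^{-1}(0)$. Then the reduced $2$-form $\omega_{X/\!\!/G}$ on $X/\!\!/G=C/G$ restricts to the Sjamaar–Lerman–Bates $2$-form $\omega_t$ on each reduced piece $C_t/G$; i.e. $\omega_t=i_t^*\omega_{X/\!\!/G}$, where $i_t:C_t/G\hookrightarrow C/G$ is the inclusion. (ii) Let $(\tilde X,\varpi)$ be a prequantum $G$-space with moment map $\Phi$ and proper $G$-action on $\tilde X$, and let $C=\Phi^{-1}(0)$. Then the reduced $1$-form $\varpi_{\tilde X/\!\!/G}$ on $\tilde X/\!\!/G=C/G$ induces $\varpi_t$ on each reduced piece $C_t/G$; i.e. $\varpi_t=i_t^*\varpi_{\tilde X/\!\!/G}$, where $i_t:C_t/G\hookrightarrow C/G$ is the inclusion.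
   Context: Diffeology: notions (plot, smooth map, subset and quotient diffeology) are those of Souriau and Iglesias-Zemmour. A differential form $\alpha$ on a diffeological space assigns to each plot $P:U\to X$ an ordinary form $P^*\alpha$ on $U$, with $(P\circ f)^*\alpha=f^*(P^*\alpha)$ for all smooth $f:V\to U$ between open subsets of Euclidean spaces; forms are pulled back by smooth maps in the obvious way. Proper: the action of $G$ on a manifold $X$ is proper if the map $G\times X\to X\times X$, $(g,x)\mapsto(x,g(x))$, is proper, i.e. compact subsets have compact preimages. Hamiltonian $G$-space: a triple $(X,\omega,\Phi)$ with $X$ a manifold on which $G$ acts smoothly, $\omega$ a $G$-invariant symplectic form, and $\Phi:X\to\mathfrak g^*$ an $\mathrm{Ad}^*$-equivariant moment map: $\mathrm i_{Z_X}\omega=-d\langle\Phi(\cdot),Z\rangle$, where $Z_X(x)=\frac{d}{dt}e^{tZ}(x)|_{t=0}$ for $Z\in\mathfrak g$. Prequantum $G$-space: a pair $(\tilde X,\varpi)$ of a manifold $\tilde X$ on which $G$ acts smoothly and a $G$-invariant contact $1$-form $\varpi$ whose Reeb vector field generates a free action of the circle group $\mathbf T=\mathrm U_1$. Its moment map $\Phi:\tilde X\to\mathfrak g^*$ is $\langle\Phi(\tilde x),Z\rangle=\varpi(Z_{\tilde X}(\tilde x))$. Reduced space and forms: $X/\!\!/G:=\Phi^{-1}(0)/G$ (resp. $\tilde X/\!\!/G:=\Phi^{-1}(0)/G$) with the subquotient diffeology (subset diffeology on $C=\Phi^{-1}(0)$, then quotient diffeology). Let $j$ be the inclusion of $C$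 and $\pi:C\to C/G$ the projection. The reduced $2$-form $\omega_{X/\!\!/G}$ is the unique diffeological $2$-form on $X/\!\!/G$ with $j^*\omega=\pi^*\omega_{X/\!\!/G}$; the reduced $1$-form $\varpi_{\tilde X/\!\!/G}$ is the unique diffeological $1$-form on $\tilde X/\!\!/G$ with $j^*\varpi=\pi^*\varpi_{\tilde X/\!\!/G}$. When the $G$-action on $X$ (resp. $\tilde X$) is proper, these forms exist (this is taken as known here). Pieces: an orbit type $t$ is a conjugacy class of closed subgroups of $G$; the orbit type piece $X_t$ (resp. $\tilde X_t$) is the set of points whose stabilizer lies in $t$, and $C_t:=C\cap X_t$ (resp. $C\cap\tilde X_t$). For proper actions, $C_t$ is a $G$-invariant embedded submanifold and $C_t/G$ is a manifold (components may have different dimensions). In the symplectic case, the Sjamaar–Lerman–Bates form $\omega_t$ is the (symplectic) $2$-form on $C_t/G$ characterized by $(j|_{C_t})^*\omega=(\pi|_{C_t})^*\omega_t$, where $j|_{C_t}:C_t\to X$ and $\pi|_{C_t}:C_t\to C_t/G$. In the prequantum case, $\varpi_t$ is the unique ordinary $1$-form on the manifold $C_t/G$ with $(j|_{C_t})^*\varpi=(\pi|_{C_t})^*\varpi_t$, where $j|_{C_t}:C_t\to\tilde X$ and $\pi|_{C_t}:C_t\to C_t/G$. *)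

theory Defs
  imports "HOL-Analysis.Analysis" "HOL-Algebra.Group_Action"
begin

section \<open>Smooth calculus on open subsets of Euclidean spaces\<close>

text \<open>
  Plots are defined on open subsets of \<open>R^n\<close> for all \<open>n\<close> simultaneously, so the dimension cannot
  be a type.  As in the library's \<^const>\<open>Euclidean_space\<close>, \<open>R^n\<close> is the set of real sequences that
  vanish from index \<open>n\<close> on.
\<close>

type_synonym evec = "nat \<Rightarrow> real"

abbreviation Rn :: "nat \<Rightarrow> evec set" where
  "Rn n \<equiv> topspace (Euclidean_space n)"

definition pdiff :: "nat \<Rightarrow> (evec \<Rightarrow> real) \<Rightarrow> evec \<Rightarrow> real" where
  "pdiff i f x = deriv (\<lambda>t. f (x(i := t))) (x i)"

primrec Ck_on :: "nat \<Rightarrow> nat \<Rightarrow> evec set \<Rightarrow> (evec \<Rightarrow> real) \<Rightarrow> bool" where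
  "Ck_on 0 n U f \<longleftrightarrow> continuous_on U f"
| "Ck_on (Suc k) n U f \<longleftrightarrow> continuous_on U f \<and>
     (\<forall>i<n. (\<forall>x\<in>U. (\<lambda>t. f (x(i := t))) field_differentiable at (x i)) \<and> Ck_on k n U (pdiff i f))"

definition smooth_fn :: "nat \<Rightarrow> evec set \<Rightarrow> (evec \<Rightarrow> real) \<Rightarrow> bool" where
  "smooth_fn n U f \<longleftrightarrow> (\<forall>k. Ck_on k n U f)"

definition smooth_map :: "nat \<Rightarrow> evec set \<Rightarrow> nat \<Rightarrow> evec set \<Rightarrow> (evec \<Rightarrow> evec) \<Rightarrow> bool" where
  "smooth_map n U m V f \<longleftrightarrow> f \<in> U \<rightarrow> V \<and> (\<forall>j<m. smooth_fn n U (\<lambda>x. f x j))"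

definition dir_deriv :: "nat \<Rightarrow> (evec \<Rightarrow> real) \<Rightarrow> evec \<Rightarrow> evec \<Rightarrow> real" where
  "dir_deriv n f x v = (\<Sum>i<n. pdiff i f x * v i)"

definition tmap :: "nat \<Rightarrow> (evec \<Rightarrow> evec) \<Rightarrow> evec \<Rightarrow> evec \<Rightarrow> evec" where
  "tmap n f x v = (\<lambda>j. dir_deriv n (\<lambda>y. f y j) x v)"


section \<open>Differential forms on open subsets of Euclidean spaces\<close>

text \<open>
  A \<open>k\<close>-form takes a point and a list of \<open>k\<close> vectors.  Its values are relevant only at points of
  its domain and on vectors of \<open>R^n\<close>; \<open>eform_eq\<close> is equality of forms.
\<close>

type_synonym eform = "evec \<Rightarrow> evec list \<Rightarrow> real"

definition vecs :: "nat \<Rightarrow> nat \<Rightarrow> evec list set" where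
  "vecs k n = {vs. length vs = k \<and> set vs \<subseteq> Rn n}"

definition eform :: "nat \<Rightarrow> nat \<Rightarrow> evec set \<Rightarrow> eform \<Rightarrow> bool" where
  "eform k n U a \<longleftrightarrow>
     (\<forall>x\<in>U. \<forall>vs\<in>vecs k n. \<forall>i<k. \<forall>v\<in>Rn n. \<forall>w\<in>Rn n. \<forall>c d.
        a x (vs[i := (\<lambda>l. c * v l + d * w l)]) = c * a x (vs[i := v]) + d * a x (vs[i := w])) \<and>
     (\<forall>x\<in>U. \<forall>vs\<in>vecs k n. \<forall>i<k. \<forall>j<k. i \<noteq> j \<and> vs ! i = vs ! j \<longrightarrow> a x vs = 0) \<and>
     (\<forall>vs\<in>vecs k n. smooth_fn n U (\<lambda>x. a x vs))"

definition eform_eq :: "nat \<Rightarrow> nat \<Rightarrow> evec set \<Rightarrow> eform \<Rightarrow> eform \<Rightarrow> bool" where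
  "eform_eq k n U a b \<longleftrightarrow> (\<forall>x\<in>U. \<forall>vs\<in>vecs k n. a x vs = b x vs)"

definition epull :: "nat \<Rightarrow> (evec \<Rightarrow> evec) \<Rightarrow> eform \<Rightarrow> eform" where
  "epull m f a = (\<lambda>x vs. a (f x) (map (tmap m f x) vs))"

text \<open>
  Exterior derivative, evaluated on constant vector fields:
  \<open>da(v\<^sub>0,\<dots>,v\<^sub>k) = \<Sum>\<^sub>j (-1)^j D\<^bsub>v\<^sub>j\<^esub> (a(v\<^sub>0,\<dots>,v\<^sub>j omitted,\<dots>,v\<^sub>k))\<close>.
\<close>

definition ext_d :: "nat \<Rightarrow> eform \<Rightarrow> eform" where
  "ext_d n a = (\<lambda>x vs. \<Sum>j<length vs.
     (-1) ^ j * dir_deriv n (\<lambda>y. a y (take j vs @ drop (Suc j) vs)) x (vs ! j))"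


section \<open>Diffeological spaces\<close>

text \<open>
  A parametrization \<open>(n, U, P)\<close> is a map \<open>P\<close> on an open subset \<open>U\<close> of \<open>R^n\<close>; \<open>P\<close> is required to be
  extensional, so that it is determined by its values on \<open>U\<close>.
\<close>

type_synonym 'a param = "nat \<times> evec set \<times> (evec \<Rightarrow> 'a)"

record 'a dspace =
  points :: "'a set"
  plots :: "'a param set"

definition params :: "'a set \<Rightarrow> 'a param set" where
  "params A = {(n, U, P). openin (Euclidean_space n) U \<and> P \<in> U \<rightarrow>\<^sub>E A}"

definition diffeological_space :: "'a dspace \<Rightarrow> bool" where
  "diffeological_space X \<longleftrightarrow>
     plots X \<subseteq> params (points X) \<and>
     (\<forall>n U. \<forall>x\<in>points X. openin (Euclidean_space n) U \<longrightarrow> (n, U, \<lambda>u\<in>U. x) \<in> plots X) \<and>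
     (\<forall>(n, U, P)\<in>params (points X).
        (\<forall>u\<in>U. \<exists>V. openin (Euclidean_space n) V \<and> u \<in> V \<and> V \<subseteq> U \<and> (n, V, restrict P V) \<in> plots X)
          \<longrightarrow> (n, U, P) \<in> plots X) \<and>
     (\<forall>(n, U, P)\<in>plots X. \<forall>m V f. openin (Euclidean_space m) V \<and> smooth_map m V n U f
          \<longrightarrow> (m, V, compose V P f) \<in> plots X)"

definition dsmooth :: "'a dspace \<Rightarrow> 'b dspace \<Rightarrow> ('a \<Rightarrow> 'b) \<Rightarrow> bool" where
  "dsmooth X Y f \<longleftrightarrow> f \<in> points X \<rightarrow> points Y \<and>
     (\<forall>(n, U, P)\<in>plots X. (n, U, compose U f P) \<in> plots Y)"

definition diffeo :: "'a dspace \<Rightarrow> 'b dspace \<Rightarrow> ('a \<Rightarrow> 'b) \<Rightarrow> bool" where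
  "diffeo X Y f \<longleftrightarrow> bij_betw f (points X) (points Y) \<and>
     dsmooth X Y f \<and> dsmooth Y X (inv_into (points X) f)"

definition dsubspace :: "'a dspace \<Rightarrow> 'a set \<Rightarrow> 'a dspace" where
  "dsubspace X A = \<lparr>points = A, plots = {(n, U, P). (n, U, P) \<in> plots X \<and> P ` U \<subseteq> A}\<rparr>"

text \<open>Quotient diffeology on \<open>q ` points X\<close>: plots are the maps that locally lift along \<open>q\<close>.\<close>

definition dquotient :: "'a dspace \<Rightarrow> ('a \<Rightarrow> 'b) \<Rightarrow> 'b dspace" where
  "dquotient X q = \<lparr>points = q ` points X,
     plots = {(n, U, P). (n, U, P) \<in> params (q ` points X) \<and>
       (\<forall>u\<in>U. \<exists>V. openin (Euclidean_space n) V \<and> u \<in> V \<and> V \<subseteq> U \<and>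
          (\<exists>Q. (n, V, Q) \<in> plots X \<and> restrict P V = compose V q Q))}\<rparr>"

definition dproduct :: "'a dspace \<Rightarrow> 'b dspace \<Rightarrow> ('a \<times> 'b) dspace" where
  "dproduct X Y = \<lparr>points = points X \<times> points Y,
     plots = {(n, U, P). (n, U, P) \<in> params (points X \<times> points Y) \<and>
       (n, U, compose U fst P) \<in> plots X \<and> (n, U, compose U snd P) \<in> plots Y}\<rparr>"

definition deuclidean :: "nat \<Rightarrow> evec set \<Rightarrow> evec dspace" where
  "deuclidean n U = \<lparr>points = U,
     plots = {(m, V, f). (m, V, f) \<in> params U \<and> smooth_map m V n U f}\<rparr>"

definition dopen :: "'a dspace \<Rightarrow> 'a set \<Rightarrow> bool" where
  "dopen X A \<longleftrightarrow> A \<subseteq> points X \<and>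
     (\<forall>(n, U, P)\<in>plots X. openin (Euclidean_space n) {u\<in>U. P u \<in> A})"

definition dtopology :: "'a dspace \<Rightarrow> 'a topology" where
  "dtopology X = topology (dopen X)"

lemma istopology_dopen: "istopology (dopen X)"
  unfolding istopology_def
proof (intro conjI allI impI)
  fix A B assume "dopen X A" "dopen X B"
  moreover have "{u\<in>U. P u \<in> A \<inter> B} = {u\<in>U. P u \<in> A} \<inter> {u\<in>U. P u \<in> B}" for U :: "evec set" and P
    by auto
  ultimately show "dopen X (A \<inter> B)"
    unfolding dopen_def by (auto simp: split_beta)
next
  fix K assume "\<forall>A\<in>K. dopen X A"
  moreover have "{u\<in>U. P u \<in> \<Union>K} = \<Union>((\<lambda>A. {u\<in>U. P u \<in> A}) ` K)" for U :: "evec set" and P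
    by auto
  ultimately show "dopen X (\<Union>K)"
    unfolding dopen_def by (auto simp: split_beta intro!: openin_Union)
qed

lemma openin_dtopology: "openin (dtopology X) = dopen X"
  by (simp add: dtopology_def istopology_dopen topology_inverse')


section \<open>Manifolds\<close>

text \<open>
  A manifold is a diffeological space that is locally diffeomorphic to Euclidean spaces, Hausdorff
  and second countable.  The dimension may vary from one component to another.
\<close>

definition charts :: "'a dspace \<Rightarrow> 'a param set" where
  "charts X = {(n, U, \<phi>). (n, U, \<phi>) \<in> params (points X) \<and> dopen X (\<phi> ` U) \<and>
     diffeo (deuclidean n U) (dsubspace X (\<phi> ` U)) \<phi>}"

definition charts_at :: "'a dspace \<Rightarrow> 'a \<Rightarrow> 'a param set" where
  "charts_at X x = {(n, U, \<phi>). (n, U, \<phi>) \<in> charts X \<and> x \<in> \<phi> ` U}"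

definition manifold :: "'a dspace \<Rightarrow> bool" where
  "manifold X \<longleftrightarrow> diffeological_space X \<and> (\<forall>x\<in>points X. charts_at X x \<noteq> {}) \<and>
     Hausdorff_space (dtopology X) \<and> second_countable (dtopology X)"

text \<open>
  A tangent vector at \<open>x\<close> is the family of its coordinate vectors in all charts at \<open>x\<close>; these are
  related by the derivatives of the coordinate changes.  (Off the charts at \<open>x\<close> the family is \<open>0\<close>.)
  The vector space operations are pointwise.
\<close>

type_synonym 'a tvec = "'a param \<Rightarrow> evec"

definition tspace :: "'a dspace \<Rightarrow> 'a \<Rightarrow> 'a tvec set" where
  "tspace X x = {v.
     (\<forall>c. c \<notin> charts_at X x \<longrightarrow> v c = (\<lambda>_. 0)) \<and>
     (\<forall>(n, U, \<phi>)\<in>charts_at X x. v (n, U, \<phi>) \<in> Rn n) \<and>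
     (\<forall>(n, U, \<phi>)\<in>charts_at X x. \<forall>(m, W, \<psi>)\<in>charts_at X x.
        v (m, W, \<psi>) = tmap n (inv_into W \<psi> \<circ> \<phi>) (inv_into U \<phi> x) (v (n, U, \<phi>)))}"

text \<open>The image in \<open>T\<^bsub>P(u)\<^esub>X\<close> of a vector at \<open>u\<close> under the tangent map of a plot \<open>P\<close>.\<close>

definition tpush :: "'a dspace \<Rightarrow> 'a param \<Rightarrow> evec \<Rightarrow> evec \<Rightarrow> 'a tvec" where
  "tpush X = (\<lambda>(n, U, P) u v (m, W, \<psi>).
     if (m, W, \<psi>) \<in> charts_at X (P u) then tmap n (inv_into W \<psi> \<circ> P) u v else (\<lambda>_. 0))"

definition velocity :: "'a dspace \<Rightarrow> (real \<Rightarrow> 'a) \<Rightarrow> real \<Rightarrow> 'a tvec" where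
  "velocity X \<gamma> t = (\<lambda>(m, W, \<psi>).
     if (m, W, \<psi>) \<in> charts_at X (\<gamma> t) then (\<lambda>i. deriv (\<lambda>s. inv_into W \<psi> (\<gamma> s) i) t) else (\<lambda>_. 0))"


section \<open>Differential forms on manifolds and on diffeological spaces\<close>

text \<open>
  An ordinary form \<open>a\<close> on a manifold is a function of a point and a list of tangent vectors at that
  point, and \<open>plot_pull X a c\<close> is the pullback of \<open>a\<close> by the plot \<open>c\<close>; if \<open>c\<close> is a chart, it is the
  local expression of \<open>a\<close>.  Since the tangent map of a chart is an isomorphism onto the tangent
  space, \<open>mform\<close> says that \<open>a\<close> is multilinear and alternating on each tangent space, and smooth.
\<close>

type_synonym 'a mform = "'a \<Rightarrow> 'a tvec list \<Rightarrow> real"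

definition plot_pull :: "'a dspace \<Rightarrow> 'a mform \<Rightarrow> 'a param \<Rightarrow> eform" where
  "plot_pull X a = (\<lambda>(n, U, P) u vs. a (P u) (map (tpush X (n, U, P) u) vs))"

definition mform :: "nat \<Rightarrow> 'a dspace \<Rightarrow> 'a mform \<Rightarrow> bool" where
  "mform k X a \<longleftrightarrow> (\<forall>(n, U, \<phi>)\<in>charts X. eform k n U (plot_pull X a (n, U, \<phi>)))"

text \<open>
  A diffeological form assigns a form to each plot.  The diffeological form of an ordinary form
  \<open>a\<close> on a manifold \<open>X\<close> is \<open>plot_pull X a\<close>.
\<close>

type_synonym 'a dform = "'a param \<Rightarrow> eform"

definition dform :: "nat \<Rightarrow> 'a dspace \<Rightarrow> 'a dform \<Rightarrow> bool" where
  "dform k X \<alpha> \<longleftrightarrow>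
     (\<forall>(n, U, P)\<in>plots X. eform k n U (\<alpha> (n, U, P)) \<and>
        (\<forall>m V f. openin (Euclidean_space m) V \<and> smooth_map m V n U f \<longrightarrow>
           eform_eq k m V (\<alpha> (m, V, compose V P f)) (epull m f (\<alpha> (n, U, P)))))"

definition dform_eq :: "nat \<Rightarrow> 'a dspace \<Rightarrow> 'a dform \<Rightarrow> 'a dform \<Rightarrow> bool" where
  "dform_eq k X \<alpha> \<beta> \<longleftrightarrow> (\<forall>(n, U, P)\<in>plots X. eform_eq k n U (\<alpha> (n, U, P)) (\<beta> (n, U, P)))"

definition dpull :: "('a \<Rightarrow> 'b) \<Rightarrow> 'b dform \<Rightarrow> 'a dform" where
  "dpull f \<alpha> = (\<lambda>(n, U, P). \<alpha> (n, U, compose U f P))"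


section \<open>Lie groups and their actions\<close>

record 'g dgroup = "'g monoid" +
  gplots :: "'g param set"

definition gspace :: "'g dgroup \<Rightarrow> 'g dspace" where
  "gspace G = \<lparr>points = carrier G, plots = gplots G\<rparr>"

definition lie_group :: "'g dgroup \<Rightarrow> bool" where
  "lie_group G \<longleftrightarrow> group G \<and> manifold (gspace G) \<and>
     dsmooth (dproduct (gspace G) (gspace G)) (gspace G) (\<lambda>(g, h). g \<otimes>\<^bsub>G\<^esub> h) \<and>
     dsmooth (gspace G) (gspace G) (m_inv G)"

definition lie_algebra :: "'g dgroup \<Rightarrow> 'g tvec set" where
  "lie_algebra G = tspace (gspace G) \<one>\<^bsub>G\<^esub>"

definition one_parameter_subgroup :: "'g dgroup \<Rightarrow> (real \<Rightarrow> 'g) \<Rightarrow> bool" where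
  "one_parameter_subgroup G \<gamma> \<longleftrightarrow> (\<forall>t. \<gamma> t \<in> carrier G) \<and> (\<forall>s t. \<gamma> (s + t) = \<gamma> s \<otimes>\<^bsub>G\<^esub> \<gamma> t) \<and>
     (1, Rn 1, \<lambda>u\<in>Rn 1. \<gamma> (u 0)) \<in> gplots G"

text \<open>\<open>lie_exp G Z t\<close> is \<open>e^{tZ}\<close>.\<close>

definition lie_exp :: "'g dgroup \<Rightarrow> 'g tvec \<Rightarrow> real \<Rightarrow> 'g" where
  "lie_exp G Z = (THE \<gamma>. one_parameter_subgroup G \<gamma> \<and> velocity (gspace G) \<gamma> 0 = Z)"

definition Ad :: "'g dgroup \<Rightarrow> 'g \<Rightarrow> 'g tvec \<Rightarrow> 'g tvec" where
  "Ad G g Z = velocity (gspace G) (\<lambda>t. g \<otimes>\<^bsub>G\<^esub> lie_exp G Z t \<otimes>\<^bsub>G\<^esub> inv\<^bsub>G\<^esub> g) 0"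

definition lie_dual :: "'g dgroup \<Rightarrow> ('g tvec \<Rightarrow> real) set" where
  "lie_dual G = {\<xi> \<in> extensional (lie_algebra G).
     \<forall>Z\<in>lie_algebra G. \<forall>W\<in>lie_algebra G. \<forall>a b.
       \<xi> (\<lambda>c i. a * Z c i + b * W c i) = a * \<xi> Z + b * \<xi> W}"

definition coAd :: "'g dgroup \<Rightarrow> 'g \<Rightarrow> ('g tvec \<Rightarrow> real) \<Rightarrow> 'g tvec \<Rightarrow> real" where
  "coAd G g \<xi> = (\<lambda>Z\<in>lie_algebra G. \<xi> (Ad G (inv\<^bsub>G\<^esub> g) Z))"

definition smooth_action :: "'g dgroup \<Rightarrow> 'a dspace \<Rightarrow> ('g \<Rightarrow> 'a \<Rightarrow> 'a) \<Rightarrow> bool" where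
  "smooth_action G X act \<longleftrightarrow> group_action G (points X) act \<and>
     dsmooth (dproduct (gspace G) X) X (\<lambda>(g, x). act g x)"

definition proper_action :: "'g dgroup \<Rightarrow> 'a dspace \<Rightarrow> ('g \<Rightarrow> 'a \<Rightarrow> 'a) \<Rightarrow> bool" where
  "proper_action G X act \<longleftrightarrow>
     (\<forall>K. compactin (prod_topology (dtopology X) (dtopology X)) K \<longrightarrow>
        compactin (prod_topology (dtopology (gspace G)) (dtopology X))
          {(g, x). g \<in> carrier G \<and> x \<in> points X \<and> (x, act g x) \<in> K})"

text \<open>The infinitesimal action \<open>Z\<^sub>X(x)\<close>.\<close>

definition inf_action ::
    "'g dgroup \<Rightarrow> 'a dspace \<Rightarrow> ('g \<Rightarrow> 'a \<Rightarrow> 'a) \<Rightarrow> 'g tvec \<Rightarrow> 'a \<Rightarrow> 'a tvec" where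
  "inf_action G X act Z x = velocity X (\<lambda>t. act (lie_exp G Z t) x) 0"

definition invariant_form ::
    "nat \<Rightarrow> 'g dgroup \<Rightarrow> 'a dspace \<Rightarrow> ('g \<Rightarrow> 'a \<Rightarrow> 'a) \<Rightarrow> 'a mform \<Rightarrow> bool" where
  "invariant_form k G X act a \<longleftrightarrow>
     (\<forall>g\<in>carrier G. dform_eq k X (dpull (act g) (plot_pull X a)) (plot_pull X a))"


section \<open>Hamiltonian and prequantum spaces\<close>

definition symplectic_form :: "'a dspace \<Rightarrow> 'a mform \<Rightarrow> bool" where
  "symplectic_form X \<omega> \<longleftrightarrow> mform 2 X \<omega> \<and>
     (\<forall>(n, U, \<phi>)\<in>charts X. \<forall>u\<in>U. \<forall>vs\<in>vecs 3 n. ext_d n (plot_pull X \<omega> (n, U, \<phi>)) u vs = 0) \<and>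
     (\<forall>x\<in>points X. \<forall>v\<in>tspace X x. (\<forall>w\<in>tspace X x. \<omega> x [v, w] = 0) \<longrightarrow> v = (\<lambda>_ _. 0))"

text \<open>
  The last conjunct is \<open>i\<^bsub>Z\<^sub>X\<^esub> \<omega> = - d\<langle>\<Phi>, Z\<rangle>\<close>, evaluated on the tangent vectors with coordinates
  \<open>w\<close> in a chart.  Smoothness of \<open>\<Phi>\<close> with values in the finite-dimensional vector space \<open>g*\<close> is
  smoothness of all its components \<open>\<langle>\<Phi>, Z\<rangle>\<close>.
\<close>

definition hamiltonian_space ::
    "'g dgroup \<Rightarrow> 'a dspace \<Rightarrow> ('g \<Rightarrow> 'a \<Rightarrow> 'a) \<Rightarrow> 'a mform \<Rightarrow> ('a \<Rightarrow> 'g tvec \<Rightarrow> real) \<Rightarrow> bool" where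
  "hamiltonian_space G X act \<omega> \<Phi> \<longleftrightarrow>
     manifold X \<and> smooth_action G X act \<and> symplectic_form X \<omega> \<and> invariant_form 2 G X act \<omega> \<and>
     \<Phi> \<in> points X \<rightarrow> lie_dual G \<and>
     (\<forall>Z\<in>lie_algebra G. \<forall>(n, U, P)\<in>plots X. smooth_fn n U (\<lambda>u. \<Phi> (P u) Z)) \<and>
     (\<forall>g\<in>carrier G. \<forall>x\<in>points X. \<Phi> (act g x) = coAd G g (\<Phi> x)) \<and>
     (\<forall>Z\<in>lie_algebra G. \<forall>(n, U, \<phi>)\<in>charts X. \<forall>u\<in>U. \<forall>w\<in>Rn n.
        \<omega> (\<phi> u) [inf_action G X act Z (\<phi> u), tpush X (n, U, \<phi>) u w] =
        - dir_deriv n (\<lambda>y. \<Phi> (\<phi> y) Z) u w)"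

text \<open>
  A contact form is a \<open>1\<close>-form \<open>a\<close> that vanishes nowhere and whose derivative \<open>da\<close> is
  nondegenerate on each hyperplane \<open>ker a\<close>.
\<close>

definition contact_form :: "'a dspace \<Rightarrow> 'a mform \<Rightarrow> bool" where
  "contact_form X \<theta> \<longleftrightarrow> mform 1 X \<theta> \<and>
     (\<forall>(n, U, \<phi>)\<in>charts X. \<forall>u\<in>U.
        let a = plot_pull X \<theta> (n, U, \<phi>) u;
            da = ext_d n (plot_pull X \<theta> (n, U, \<phi>)) u;
            K = {v \<in> Rn n. a [v] = 0}
        in K \<noteq> Rn n \<and> (\<forall>v\<in>K. (\<forall>w\<in>K. da [v, w] = 0) \<longrightarrow> v = (\<lambda>_. 0)))"

definition reeb_field :: "'a dspace \<Rightarrow> 'a mform \<Rightarrow> ('a \<Rightarrow> 'a tvec) \<Rightarrow> bool" where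
  "reeb_field X \<theta> R \<longleftrightarrow>
     (\<forall>x\<in>points X. R x \<in> tspace X x \<and> \<theta> x [R x] = 1) \<and>
     (\<forall>(n, U, \<phi>)\<in>charts X. \<forall>u\<in>U. \<forall>w\<in>Rn n.
        ext_d n (plot_pull X \<theta> (n, U, \<phi>)) u [R (\<phi> u) (n, U, \<phi>), w] = 0)"

definition circle_group :: "complex dgroup" where
  "circle_group = \<lparr>carrier = {z. cmod z = 1}, mult = (*), one = 1,
     gplots = {(n, U, P). (n, U, P) \<in> params {z. cmod z = 1} \<and>
       smooth_fn n U (\<lambda>u. Re (P u)) \<and> smooth_fn n U (\<lambda>u. Im (P u))}\<rparr>"

text \<open>
  The Reeb field generates the circle action \<open>\<rho>\<close> if it is the infinitesimal generator of the flow
  \<open>t \<mapsto> \<rho> (e^{it})\<close>, so that its orbits have period \<open>2\<pi>\<close>.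
\<close>

definition prequantum_space ::
    "'g dgroup \<Rightarrow> 'a dspace \<Rightarrow> ('g \<Rightarrow> 'a \<Rightarrow> 'a) \<Rightarrow> 'a mform \<Rightarrow> bool" where
  "prequantum_space G X act \<theta> \<longleftrightarrow>
     manifold X \<and> smooth_action G X act \<and> contact_form X \<theta> \<and> invariant_form 1 G X act \<theta> \<and>
     (\<exists>\<rho>. smooth_action circle_group X \<rho> \<and>
        (\<forall>z\<in>carrier circle_group. \<forall>x\<in>points X. \<rho> z x = x \<longrightarrow> z = 1) \<and>
        reeb_field X \<theta> (\<lambda>x. velocity X (\<lambda>t. \<rho> (cis t) x) 0))"

definition prequantum_moment ::
    "'g dgroup \<Rightarrow> 'a dspace \<Rightarrow> ('g \<Rightarrow> 'a \<Rightarrow> 'a) \<Rightarrow> 'a mform \<Rightarrow> 'a \<Rightarrow> 'g tvec \<Rightarrow> real" where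
  "prequantum_moment G X act \<theta> x = (\<lambda>Z\<in>lie_algebra G. \<theta> x [inf_action G X act Z x])"

definition zero_level :: "'g dgroup \<Rightarrow> 'a dspace \<Rightarrow> ('a \<Rightarrow> 'g tvec \<Rightarrow> real) \<Rightarrow> 'a set" where
  "zero_level G X \<Phi> = {x \<in> points X. \<Phi> x = (\<lambda>Z\<in>lie_algebra G. 0)}"


section \<open>Reduction\<close>

definition orbit_space ::
    "'g dgroup \<Rightarrow> 'a dspace \<Rightarrow> ('g \<Rightarrow> 'a \<Rightarrow> 'a) \<Rightarrow> 'a set \<Rightarrow> 'a set dspace" where
  "orbit_space G X act C = dquotient (dsubspace X C) (orbit G act)"

text \<open>\<open>j* a = \<pi>* \<alpha>\<close> for a diffeological form \<open>\<alpha>\<close> on \<open>C/G\<close>; here \<open>j\<close> is \<open>\<lambda>x. x\<close>.\<close>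

definition reduced_form ::
    "nat \<Rightarrow> 'g dgroup \<Rightarrow> 'a dspace \<Rightarrow> ('g \<Rightarrow> 'a \<Rightarrow> 'a) \<Rightarrow> 'a mform \<Rightarrow> 'a set \<Rightarrow> 'a set dform \<Rightarrow> bool" where
  "reduced_form k G X act a C \<alpha> \<longleftrightarrow> dform k (orbit_space G X act C) \<alpha> \<and>
     dform_eq k (dsubspace X C) (dpull (\<lambda>x. x) (plot_pull X a)) (dpull (orbit G act) \<alpha>)"

definition orbit_types :: "'g dgroup \<Rightarrow> 'g set set set" where
  "orbit_types G = {t. \<exists>H. subgroup H G \<and> closedin (dtopology (gspace G)) H \<and>
     t = {g <#\<^bsub>G\<^esub> H #>\<^bsub>G\<^esub> inv\<^bsub>G\<^esub> g | g. g \<in> carrier G}}"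

definition orbit_type_piece ::
    "'g dgroup \<Rightarrow> 'a dspace \<Rightarrow> ('g \<Rightarrow> 'a \<Rightarrow> 'a) \<Rightarrow> 'g set set \<Rightarrow> 'a set" where
  "orbit_type_piece G X act t = {x \<in> points X. stabilizer G act x \<in> t}"

text \<open>
  \<open>(j|C\<^sub>t)* a = (\<pi>|C\<^sub>t)* b\<close> for an ordinary form \<open>b\<close> on the manifold \<open>C\<^sub>t/G\<close>, where \<open>C\<^sub>t\<close> is given
  as \<open>D\<close>.  The manifold structures of \<open>C\<^sub>t\<close> (embedded in \<open>X\<close>) and of \<open>C\<^sub>t/G\<close> (base of the submersion
  \<open>\<pi>|C\<^sub>t\<close>) are those of the subset and the quotient diffeology.
\<close>

definition piece_form ::
    "nat \<Rightarrow> 'g dgroup \<Rightarrow> 'a dspace \<Rightarrow> ('g \<Rightarrow> 'a \<Rightarrow> 'a) \<Rightarrow> 'a mform \<Rightarrow> 'a set \<Rightarrow> 'a set mform \<Rightarrow> bool" where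
  "piece_form k G X act a D b \<longleftrightarrow> mform k (orbit_space G X act D) b \<and>
     dform_eq k (dsubspace X D) (dpull (\<lambda>x. x) (plot_pull X a))
       (dpull (orbit G act) (plot_pull (orbit_space G X act D) b))"

end

theory Submission
  imports Defs
begin

text \<open>
  A plot of \<open>C\<^sub>t/G\<close> lifts locally to a plot \<open>Q\<close> of \<open>C\<^sub>t\<close>, which is also a plot of \<open>C\<close>. Hence, on the
  domain of \<open>Q\<close>, the pullbacks of both forms on \<open>C\<^sub>t/G\<close> equal the pullback of the form on \<open>X\<close> by \<open>Q\<close>.
  Forms are determined locally, so the two forms agree.
\<close>

lemma pdiff_const: "pdiff i (\<lambda>x. c) = (\<lambda>x. 0)"
  by (simp add: pdiff_def fun_eq_iff)

lemma pdiff_component: "pdiff i (\<lambda>x. x j) = (\<lambda>x. if i = j then 1 else 0)"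
  by (auto simp: pdiff_def fun_eq_iff)

lemma smooth_fn_const: "smooth_fn n U (\<lambda>x. c)"
proof -
  have "Ck_on k n U (\<lambda>x. c)" for k
    by (induction k arbitrary: c) (auto simp: pdiff_const)
  then show ?thesis
    by (simp add: smooth_fn_def)
qed

text \<open>The partial derivatives are the constants 0 and 1, so beyond order 0 everything reduces
  to smoothness of constants and a case split on the order suffices.\<close>

lemma smooth_fn_component: "smooth_fn n U (\<lambda>x. x j)"
proof -
  have cont: "continuous_on U (\<lambda>x::evec. x j)"
    by (rule continuous_on_subset[OF continuous_on_product_coordinates]) simp
  have diff: "(\<lambda>t. (x(i := t)) j) field_differentiable at (x i)" for x :: evec and i
    by (cases "i = j") auto
  have "Ck_on k n U (\<lambda>x. x j)" for k
    using smooth_fn_const[of n U "if i = j then 1 else 0" for i] cont diff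
    by (cases k) (auto simp: pdiff_component smooth_fn_def)
  then show ?thesis
    by (simp add: smooth_fn_def)
qed

lemma smooth_map_inclusion: "V \<subseteq> U \<Longrightarrow> smooth_map n V n U (\<lambda>x. x)"
  by (auto simp: smooth_map_def smooth_fn_component)

text \<open>\<open>tmap n\<close> sums over the first \<open>n\<close> coordinates only and thus
  returns 0 from index \<open>n\<close> on; \<open>v\<close> must vanish there too.\<close>

lemma tmap_id:
  assumes "v \<in> Rn n"
  shows "tmap n (\<lambda>x. x) u v = v"
proof
  fix j
  have "v j = 0" if "\<not> j < n"
    using assms that by (simp add: topspace_Euclidean_space)
  then show "tmap n (\<lambda>x. x) u v j = v j"
    by (auto simp: tmap_def dir_deriv_def pdiff_component if_distribR if_distrib[of "\<lambda>c. c * _"]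
        cong: if_cong)
qed

text \<open>\<open>pdiff\<close> differentiates along coordinate lines. For \<open>i < n\<close>
  such a line through \<open>u\<close> stays in \<open>Rn n\<close> and is continuous there, so the
  preimage of \<open>V\<close> is open in the real line.\<close>

lemma eventually_fun_upd_in:
  assumes V: "openin (Euclidean_space n) V" and "u \<in> V" and "i < n"
  shows "eventually (\<lambda>t. u(i := t) \<in> V) (nhds (u i))"
proof -
  have u: "u \<in> Rn n"
    using openin_subset[OF V] \<open>u \<in> V\<close> by blast
  have "continuous_map euclideanreal (Euclidean_space n) (\<lambda>t. u(i := t))"
    using u \<open>i < n\<close>
    by (auto simp: Euclidean_space_def continuous_map_in_subtopology continuous_map_componentwise_UNIV
        topspace_subtopology)
  then have "openin euclideanreal {t. u(i := t) \<in> V}"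
    using openin_continuous_map_preimage[OF _ V] by fastforce
  then show ?thesis
    using \<open>u \<in> V\<close> by (auto simp: eventually_nhds intro!: exI[of _ "{t. u(i := t) \<in> V}"])
qed

text \<open>Each partial derivative at \<open>u\<close> depends only on the function near
  \<open>u\<close> on a coordinate line, which lies in \<open>V\<close> there.\<close>

lemma tmap_cong:
  assumes "openin (Euclidean_space n) V" "u \<in> V" "\<And>x. x \<in> V \<Longrightarrow> f x = g x"
  shows "tmap n f u v = tmap n g u v"
proof -
  have "pdiff i (\<lambda>y. f y j) u = pdiff i (\<lambda>y. g y j) u" if "i < n" for i j
    unfolding pdiff_def using eventually_fun_upd_in[OF assms(1,2) that]
    by (intro deriv_cong_ev) (auto elim!: eventually_mono simp: assms(3))
  then show ?thesis
    by (simp add: tmap_def dir_deriv_def)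
qed

lemma tpush_restrict:
  assumes "openin (Euclidean_space n) V" "u \<in> V"
  shows "tpush X (n, V, restrict P V) u v = tpush X (n, U, P) u v"
proof -
  have "tmap n (inv_into W \<psi> \<circ> restrict P V) u v = tmap n (inv_into W \<psi> \<circ> P) u v" for W \<psi>
    using assms by (intro tmap_cong) auto
  then show ?thesis
    using assms(2) by (auto simp: tpush_def)
qed

text \<open>An ordinary form sees a plot at \<open>u\<close> only through its value and its
  derivative at \<open>u\<close>.\<close>

lemma plot_pull_restrict:
  assumes "openin (Euclidean_space n) V" "u \<in> V"
  shows "plot_pull X a (n, V, restrict P V) u vs = plot_pull X a (n, U, P) u vs"
  using assms by (simp add: plot_pull_def tpush_restrict[where U = U] cong: map_cong)

text \<open>A diffeological form may a priori depend on the whole plot. Locality comes from its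
  compatibility with the inclusion of \<open>V\<close> into \<open>U\<close>, whose tangent map
  fixes the vectors of \<open>Rn n\<close>.\<close>

lemma dform_restrict:
  assumes "dform k X \<alpha>" "(n, U, P) \<in> plots X" "openin (Euclidean_space n) V" "V \<subseteq> U"
    and "u \<in> V" "vs \<in> vecs k n"
  shows "\<alpha> (n, V, restrict P V) u vs = \<alpha> (n, U, P) u vs"
proof -
  have "eform_eq k n V (\<alpha> (n, V, compose V P (\<lambda>x. x))) (epull n (\<lambda>x. x) (\<alpha> (n, U, P)))"
    using assms smooth_map_inclusion[of V U n] unfolding dform_def by blast
  moreover have "map (tmap n (\<lambda>x. x) u) vs = vs"
    using \<open>vs \<in> vecs k n\<close> by (intro map_idI tmap_id) (auto simp: vecs_def)
  moreover have "compose V P (\<lambda>x. x) = restrict P V"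
    by (simp add: compose_def restrict_def)
  ultimately show ?thesis
    using assms by (simp add: eform_eq_def epull_def)
qed

lemma dform_eqD:
  assumes "dform_eq k X \<alpha> \<beta>" "(n, U, P) \<in> plots X" "u \<in> U" "vs \<in> vecs k n"
  shows "\<alpha> (n, U, P) u vs = \<beta> (n, U, P) u vs"
  using assms by (fastforce simp: dform_eq_def eform_eq_def)

lemma plots_orbit_space_iff:
  "(n, U, P) \<in> plots (orbit_space G X act C) \<longleftrightarrow>
     openin (Euclidean_space n) U \<and> P \<in> U \<rightarrow>\<^sub>E orbit G act ` C \<and>
     (\<forall>u\<in>U. \<exists>V. openin (Euclidean_space n) V \<and> u \<in> V \<and> V \<subseteq> U \<and>
        (\<exists>Q. (n, V, Q) \<in> plots (dsubspace X C) \<and> restrict P V = compose V (orbit G act) Q))"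
  by (simp add: orbit_space_def dquotient_def params_def dsubspace_def)

lemma plots_dsubspace_mono: "D \<subseteq> C \<Longrightarrow> plots (dsubspace X D) \<subseteq> plots (dsubspace X C)"
  by (auto simp: dsubspace_def)

text \<open>Local lifts to \<open>D\<close> are also local lifts to \<open>C\<close>. An orbit is
  the same set in both quotients, so this is smoothness of the inclusion of D/G in C/G.\<close>

lemma plots_orbit_space_mono:
  assumes "D \<subseteq> C" "(n, U, P) \<in> plots (orbit_space G X act D)"
  shows "(n, U, P) \<in> plots (orbit_space G X act C)"
proof -
  have "U \<rightarrow>\<^sub>E orbit G act ` D \<subseteq> U \<rightarrow>\<^sub>E orbit G act ` C"
    by (intro PiE_mono image_mono assms)
  with assms(2) plots_dsubspace_mono[OF assms(1), of X] show ?thesis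
    unfolding plots_orbit_space_iff by (meson subsetD)
qed

text \<open>Degree and subset are left general so that the symplectic case (\<open>k = 2\<close>)
  and the prequantum case (\<open>k = 1\<close>) share one argument.\<close>

lemma reduced_form_restricts_to_piece_form:
  assumes red: "reduced_form k G X act a C \<alpha>" and piece: "piece_form k G X act a D b"
    and "D \<subseteq> C"
  shows "dform_eq k (orbit_space G X act D) (plot_pull (orbit_space G X act D) b)
    (dpull (\<lambda>y. y) \<alpha>)"
proof -
  let ?\<pi> = "orbit G act" and ?Y = "orbit_space G X act D"
  have a: "dform_eq k (dsubspace X C) (dpull (\<lambda>x. x) (plot_pull X a)) (dpull ?\<pi> \<alpha>)"
    using red by (simp add: reduced_form_def)
  have b: "dform_eq k (dsubspace X D) (dpull (\<lambda>x. x) (plot_pull X a)) (dpull ?\<pi> (plot_pull ?Y b))"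
    using piece by (simp add: piece_form_def)
  have "plot_pull ?Y b (n, U, P) u vs = \<alpha> (n, U, compose U (\<lambda>y. y) P) u vs"
    if P: "(n, U, P) \<in> plots ?Y" and u: "u \<in> U" and vs: "vs \<in> vecs k n" for n U P u vs
  proof -
    obtain V Q where V: "openin (Euclidean_space n) V" "u \<in> V" "V \<subseteq> U"
      and Q: "(n, V, Q) \<in> plots (dsubspace X D)" and lift: "restrict P V = compose V ?\<pi> Q"
      using P u unfolding plots_orbit_space_iff by blast
    have QC: "(n, V, Q) \<in> plots (dsubspace X C)"
      using Q plots_dsubspace_mono[OF \<open>D \<subseteq> C\<close>] by blast
    have PC: "(n, U, P) \<in> plots (orbit_space G X act C)"
      using \<open>D \<subseteq> C\<close> P by (rule plots_orbit_space_mono)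
    \<comment> \<open>Forms take the parametrization itself as argument, so composing with the
      inclusion must return exactly \<open>P\<close>, not just a map agreeing with it on
      \<open>U\<close>.\<close>
    have "P \<in> extensional U"
      using P unfolding plots_orbit_space_iff PiE_iff by blast
    then have comp: "compose U (\<lambda>y. y) P = P"
      by (simp add: compose_def extensional_restrict)
    have "plot_pull ?Y b (n, U, P) u vs = plot_pull ?Y b (n, V, restrict P V) u vs"
      using V(1,2) by (rule plot_pull_restrict[symmetric])
    \<comment> \<open>The pullback of \<open>a\<close> by the lift \<open>Q\<close> is the common
      middle term: it is reached here by reading \<open>Q\<close> as a plot of \<open>D\<close>, and
      left in the next step by reading \<open>Q\<close> as a plot of \<open>C\<close>.\<close>
    also have "\<dots> = plot_pull X a (n, V, compose V (\<lambda>x. x) Q) u vs"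
      using dform_eqD[OF b Q V(2) vs] by (simp only: dpull_def prod.case lift)
    also have "\<dots> = \<alpha> (n, V, restrict P V) u vs"
      using dform_eqD[OF a QC V(2) vs] by (simp only: dpull_def prod.case lift)
    also have "\<dots> = \<alpha> (n, U, P) u vs"
      using dform_restrict[OF _ PC V(1,3,2) vs] red by (simp add: reduced_form_def)
    finally show ?thesis
      by (simp add: comp)
  qed
  then show ?thesis
    by (auto simp: dform_eq_def eform_eq_def dpull_def)
qed

theorem corollary8p11:
  fixes G :: "'g dgroup"
  assumes "lie_group G"
  shows
    "(\<forall>(X :: 'a dspace) act \<omega> \<Phi> C \<omega>_red.
        hamiltonian_space G X act \<omega> \<Phi> \<longrightarrow> proper_action G X act \<longrightarrow>
        C = zero_level G X \<Phi> \<longrightarrow> reduced_form 2 G X act \<omega> C \<omega>_red \<longrightarrow>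
        (\<forall>t\<in>orbit_types G. \<forall>C\<^sub>t \<omega>\<^sub>t.
           C\<^sub>t = C \<inter> orbit_type_piece G X act t \<longrightarrow> piece_form 2 G X act \<omega> C\<^sub>t \<omega>\<^sub>t \<longrightarrow>
           dform_eq 2 (orbit_space G X act C\<^sub>t)
             (plot_pull (orbit_space G X act C\<^sub>t) \<omega>\<^sub>t) (dpull (\<lambda>y. y) \<omega>_red)))
     \<and>
     (\<forall>(X :: 'b dspace) act \<theta> \<Phi> C \<theta>_red.
        prequantum_space G X act \<theta> \<longrightarrow> \<Phi> = prequantum_moment G X act \<theta> \<longrightarrow>
        proper_action G X act \<longrightarrow>
        C = zero_level G X \<Phi> \<longrightarrow> reduced_form 1 G X act \<theta> C \<theta>_red \<longrightarrow>
        (\<forall>t\<in>orbit_types G. \<forall>C\<^sub>t \<theta>\<^sub>t.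
           C\<^sub>t = C \<inter> orbit_type_piece G X act t \<longrightarrow> piece_form 1 G X act \<theta> C\<^sub>t \<theta>\<^sub>t \<longrightarrow>
           dform_eq 1 (orbit_space G X act C\<^sub>t)
             (plot_pull (orbit_space G X act C\<^sub>t) \<theta>\<^sub>t) (dpull (\<lambda>y. y) \<theta>_red)))"
  \<comment> \<open>The required inclusion holds because \<open>C\<^sub>t\<close> is an intersection
    with \<open>C\<close>.\<close>
  by (intro conjI allI impI ballI; elim reduced_form_restricts_to_piece_form) auto

end
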